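(* Let $R$ be a ring with $1\neq 0$, let $\Lambda$ be a set, and let $\Delta\subseteq\Lambda\times\Lambda$ satisfy axioms (A1) and (A2). For every $k\geq 1$ and every closed subset $\Gamma$ of $\Delta$, $$\gamma_k(G(\Gamma))/\gamma_{k+1}(G(\Gamma))\cong (R^+)^{(\gamma_k(\Gamma)\setminus\gamma_{k+1}(\Gamma))},$$ the restricted direct product (direct sum) of $|\gamma_k(\Gamma)\setminus\gamma_{k+1}(\Gamma)|$ copies of the additive group $R^+$ of $R$.
   Context: Rings are associative and unital, not necessarily commutative. For a subset $\Delta\subseteq\Lambda\times\Lambda$ the axioms are: (A1) $(i,i)\notin\Delta$ for all $i\in\Lambda$; (A2) whenever $(i,j),(j,k),(k,\ell),(i,\ell)\in\Delta$, one has $(i,k)\in\Delta\Leftrightarrow(j,\ell)\in\Delta$. $R\Delta$ is the free $R$-module with basis $\{e_{i,j} : (i,j)\in\Delta\}$, made into a (nonunital) ring by $(ae_{i,j})(be_{k,\ell})=ab\,e_{i,\ell}$ if $j=k$ and $(i,\ell)\in\Delta$, and $(ae_{i,j})(be_{k,\ell})=0$ otherwise. Adjoining $1$ gives the ring $R\cdot 1\oplus R\Delta$ (scalars from $R$ commute with the basis elements, i.e. $e_{i,j}\cdot r=r e_{i,j}$), and $G(\Delta)=\{1+x : x\in R\Delta\}$, a subgroup of its unit group. A subset $\Gamma\subseteq\Delta$ is closed if $(i,j),(j,k)\in\Gamma$ and $(i,k)\in\Delta$ imply $(i,k)\in\Gamma$. In that case $G(\Gamma)=\{1+x: x\in R\Gamma\}$,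 where $R\Gamma$ is the $R$-span of the $e_{i,j}$ with $(i,j)\in\Gamma$, is a subgroup of $G(\Delta)$. For subsets $\Gamma_1,\Gamma_2\subseteq\Delta$, $[\Gamma_1,\Gamma_2]$ is the set of all $(i,k)\in\Delta$ for which there is $j\in\Lambda$ with $(i,j)\in\Gamma_1$ and $(j,k)\in\Gamma_2$, or there is $j\in\Lambda$ with $(i,j)\in\Gamma_2$ and $(j,k)\in\Gamma_1$. For $\Gamma\subseteq\Delta$: $\gamma_1(\Gamma)=\Gamma$ and $\gamma_{k+1}(\Gamma)=[\gamma_k(\Gamma),\Gamma]$. For a group $H$: $\gamma_1(H)=H$ and $\gamma_{k+1}(H)=[\gamma_k(H),H]$ (the descending central series). *)

theory Defs
  imports "HOL-Algebra.Algebra"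
begin

section \<open>Axioms on index sets\<close>

definition axiom_A1 :: "'i set \<Rightarrow> ('i \<times> 'i) set \<Rightarrow> bool" where
  "axiom_A1 \<Lambda> \<Delta> \<longleftrightarrow> (\<forall>i\<in>\<Lambda>. (i, i) \<notin> \<Delta>)"

definition axiom_A2 :: "('i \<times> 'i) set \<Rightarrow> bool" where
  "axiom_A2 \<Delta> \<longleftrightarrow>
     (\<forall>i j k l. (i, j) \<in> \<Delta> \<longrightarrow> (j, k) \<in> \<Delta> \<longrightarrow> (k, l) \<in> \<Delta> \<longrightarrow> (i, l) \<in> \<Delta> \<longrightarrow>
        ((i, k) \<in> \<Delta> \<longleftrightarrow> (j, l) \<in> \<Delta>))"

definition closed_subset :: "('i \<times> 'i) set \<Rightarrow> ('i \<times> 'i) set \<Rightarrow> bool" where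
  "closed_subset \<Delta> \<Gamma> \<longleftrightarrow> \<Gamma> \<subseteq> \<Delta> \<and>
     (\<forall>i j k. (i, j) \<in> \<Gamma> \<longrightarrow> (j, k) \<in> \<Gamma> \<longrightarrow> (i, k) \<in> \<Delta> \<longrightarrow> (i, k) \<in> \<Gamma>)"

definition index_bracket ::
  "('i \<times> 'i) set \<Rightarrow> ('i \<times> 'i) set \<Rightarrow> ('i \<times> 'i) set \<Rightarrow> ('i \<times> 'i) set" where
  "index_bracket \<Delta> \<Gamma>\<^sub>1 \<Gamma>\<^sub>2 =
     {(i, k). (i, k) \<in> \<Delta> \<and>
        ((\<exists>j. (i, j) \<in> \<Gamma>\<^sub>1 \<and> (j, k) \<in> \<Gamma>\<^sub>2) \<or> (\<exists>j. (i, j) \<in> \<Gamma>\<^sub>2 \<and> (j, k) \<in> \<Gamma>\<^sub>1))}"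

text \<open>The two central series below start at index 1; their value at index 0 is a dummy.\<close>

fun index_gamma :: "('i \<times> 'i) set \<Rightarrow> ('i \<times> 'i) set \<Rightarrow> nat \<Rightarrow> ('i \<times> 'i) set" where
  "index_gamma \<Delta> \<Gamma> 0 = \<Gamma>"
| "index_gamma \<Delta> \<Gamma> (Suc 0) = \<Gamma>"
| "index_gamma \<Delta> \<Gamma> (Suc (Suc k)) = index_bracket \<Delta> (index_gamma \<Delta> \<Gamma> (Suc k)) \<Gamma>"

section \<open>The descending central series of a group\<close>

definition commutator_subgroup :: "('a, 'b) monoid_scheme \<Rightarrow> 'a set \<Rightarrow> 'a set \<Rightarrow> 'a set" where
  "commutator_subgroup G A B =
     generate G (\<Union>a\<in>A. \<Union>b\<in>B. {a \<otimes>\<^bsub>G\<^esub> b \<otimes>\<^bsub>G\<^esub> inv\<^bsub>G\<^esub> a \<otimes>\<^bsub>G\<^esub> inv\<^bsub>G\<^esub> b})"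

fun lower_central :: "('a, 'b) monoid_scheme \<Rightarrow> nat \<Rightarrow> 'a set" where
  "lower_central G 0 = carrier G"
| "lower_central G (Suc 0) = carrier G"
| "lower_central G (Suc (Suc k)) = commutator_subgroup G (lower_central G (Suc k)) (carrier G)"

section \<open>The nonunital ring \<open>R\<Delta>\<close> and its unital extension\<close>

text \<open>
  An element \<open>\<Sum> a\<^sub>i\<^sub>j e\<^sub>i\<^sub>j\<close> of the free module on \<open>\<Gamma>\<close> is the finitely supported
  function \<open>(i, j) \<mapsto> a\<^sub>i\<^sub>j\<close>, which is zero outside \<open>\<Gamma>\<close>. For \<open>\<Gamma> \<subseteq> \<Delta>\<close> the span of
  the \<open>e\<^sub>i\<^sub>j\<close> with \<open>(i, j) \<in> \<Gamma>\<close> is then a subset of the module on \<open>\<Delta>\<close>.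
\<close>

definition free_span :: "('r, 'm) ring_scheme \<Rightarrow> ('i \<times> 'i) set \<Rightarrow> ('i \<times> 'i \<Rightarrow> 'r) set" where
  "free_span R \<Gamma> =
     {x. (\<forall>p. x p \<in> carrier R) \<and> (\<forall>p. p \<notin> \<Gamma> \<longrightarrow> x p = \<zero>\<^bsub>R\<^esub>) \<and> finite {p. x p \<noteq> \<zero>\<^bsub>R\<^esub>}}"

definition monomial :: "('r, 'm) ring_scheme \<Rightarrow> 'r \<Rightarrow> 'i \<times> 'i \<Rightarrow> 'i \<times> 'i \<Rightarrow> 'r" where
  "monomial R a p = (\<lambda>q. if q = p then a else \<zero>\<^bsub>R\<^esub>)"

text \<open>The product \<open>(a e\<^sub>i\<^sub>j) (b e\<^sub>k\<^sub>l)\<close>.\<close>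

definition monomial_mult ::
  "('r, 'm) ring_scheme \<Rightarrow> ('i \<times> 'i) set \<Rightarrow> 'r \<Rightarrow> 'i \<times> 'i \<Rightarrow> 'r \<Rightarrow> 'i \<times> 'i \<Rightarrow> 'i \<times> 'i \<Rightarrow> 'r" where
  "monomial_mult R \<Delta> a p b q =
     (case (p, q) of ((i, j), (k, l)) \<Rightarrow>
        if j = k \<and> (i, l) \<in> \<Delta> then monomial R (a \<otimes>\<^bsub>R\<^esub> b) (i, l) else (\<lambda>_. \<zero>\<^bsub>R\<^esub>))"

text \<open>
  The biadditive extension of the previous product, coefficient by coefficient. Summation
  runs over the supports because \<^const>\<open>finsum\<close> is only meaningful on finite sets.
\<close>

definition span_mult ::
  "('r, 'm) ring_scheme \<Rightarrow> ('i \<times> 'i) set \<Rightarrow> ('i \<times> 'i \<Rightarrow> 'r) \<Rightarrow> ('i \<times> 'i \<Rightarrow> 'r) \<Rightarrow> 'i \<times> 'i \<Rightarrow> 'r" where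
  "span_mult R \<Delta> x y = (\<lambda>s.
     \<Oplus>\<^bsub>R\<^esub>p\<in>{p. x p \<noteq> \<zero>\<^bsub>R\<^esub>}. \<Oplus>\<^bsub>R\<^esub>q\<in>{q. y q \<noteq> \<zero>\<^bsub>R\<^esub>}. monomial_mult R \<Delta> (x p) p (y q) q s)"

text \<open>
  The pair \<open>(r, x)\<close> stands for \<open>r \<cdot> 1 + x\<close>. As scalars commute with the basis elements,
  \<open>x \<cdot> s\<close> has coefficients \<open>x p \<otimes> s\<close>.
\<close>

definition unital_ext :: "('r, 'm) ring_scheme \<Rightarrow> ('i \<times> 'i) set \<Rightarrow> ('r \<times> ('i \<times> 'i \<Rightarrow> 'r)) ring" where
  "unital_ext R \<Delta> =
     \<lparr>carrier = carrier R \<times> free_span R \<Delta>,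
      monoid.mult = (\<lambda>(r, x) (s, y).
        (r \<otimes>\<^bsub>R\<^esub> s, \<lambda>p. r \<otimes>\<^bsub>R\<^esub> y p \<oplus>\<^bsub>R\<^esub> x p \<otimes>\<^bsub>R\<^esub> s \<oplus>\<^bsub>R\<^esub> span_mult R \<Delta> x y p)),
      monoid.one = (\<one>\<^bsub>R\<^esub>, \<lambda>_. \<zero>\<^bsub>R\<^esub>),
      ring.zero = (\<zero>\<^bsub>R\<^esub>, \<lambda>_. \<zero>\<^bsub>R\<^esub>),
      ring.add = (\<lambda>(r, x) (s, y). (r \<oplus>\<^bsub>R\<^esub> s, \<lambda>p. x p \<oplus>\<^bsub>R\<^esub> y p))\<rparr>"

definition unip_group ::
  "('r, 'm) ring_scheme \<Rightarrow> ('i \<times> 'i) set \<Rightarrow> ('i \<times> 'i) set \<Rightarrow> ('r \<times> ('i \<times> 'i \<Rightarrow> 'r)) monoid" where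
  "unip_group R \<Delta> \<Gamma> =
     (units_of (unital_ext R \<Delta>))\<lparr>carrier := {(\<one>\<^bsub>R\<^esub>, x) | x. x \<in> free_span R \<Gamma>}\<rparr>"

end

theory Submission
  imports Defs
begin

text \<open>
  A finite nonempty closed set contains a pair \<open>p\<close> that is not a composite of two of its
  pairs, and multiplying \<open>1 + x\<close> on the left by \<open>1 - x\<^sub>p e\<^sub>p\<close> removes \<open>p\<close> from the support.
  Hence for closed \<open>T\<close> every element of \<open>G(T)\<close> is a finite product of elements \<open>1 + a e\<^sub>p\<close>
  with \<open>p \<in> T\<close>, which yields inverses as well as generators. Put \<open>A = \<gamma>\<^sub>k(\<Gamma>)\<close> and
  \<open>B = [A, \<Gamma>]\<close>. Products of \<open>RA\<close> and \<open>R\<Gamma>\<close> in either order lie in \<open>RB\<close>, so modulo \<open>RB\<close>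
  the elements of \<open>G(A)\<close> commute with those of \<open>G(\<Gamma>)\<close>, while
  \<open>[1 + b e\<^sub>i\<^sub>j, 1 + c e\<^sub>j\<^sub>l] = 1 + bc e\<^sub>i\<^sub>l\<close> produces all generators of \<open>G(B)\<close>; thus
  \<open>\<gamma>\<^sub>k(G(\<Gamma>)) = G(\<gamma>\<^sub>k(\<Gamma>))\<close>. Finally \<open>(1 + x) (1 + y) \<equiv> 1 + x + y\<close> modulo \<open>RB\<close>, so reading off
  the coefficients at \<open>A - B\<close> is a homomorphism on \<open>G(A)\<close> with kernel \<open>G(B)\<close>.
\<close>

section \<open>Two facts on finite sums\<close>

lemma (in abelian_monoid) finsum_single:
  assumes "finite A" "c \<in> carrier G" "q \<notin> A \<Longrightarrow> c = \<zero>"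
  shows "(\<Oplus>r\<in>A. if r = q then c else \<zero>) = c"
proof (cases "q \<in> A")
  case True
  then show ?thesis
    using add.finprod_singleton_swap[of q A "\<lambda>_. c"] assms by simp
next
  case False
  then have "(\<Oplus>r\<in>A. if r = q then c else \<zero>) = (\<Oplus>r\<in>A. \<zero>)"
    using assms by (intro finsum_cong') auto
  then show ?thesis using False assms by simp
qed

lemma (in abelian_monoid) finsum_swap:
  assumes "finite A" "finite B" "\<And>a b. a \<in> A \<Longrightarrow> b \<in> B \<Longrightarrow> f a b \<in> carrier G"
  shows "(\<Oplus>a\<in>A. \<Oplus>b\<in>B. f a b) = (\<Oplus>b\<in>B. \<Oplus>a\<in>A. f a b)"
  using assms(1,3)
proof (induction A rule: finite_induct)
  case empty
  then show ?case by simp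
next
  case (insert a A)
  have "(\<Oplus>b\<in>B. \<Oplus>a\<in>insert a A. f a b) = (\<Oplus>b\<in>B. f a b \<oplus> (\<Oplus>a\<in>A. f a b))"
    using insert by (intro finsum_cong') (auto simp: Pi_def)
  also have "\<dots> = (\<Oplus>b\<in>B. f a b) \<oplus> (\<Oplus>b\<in>B. \<Oplus>a\<in>A. f a b)"
    using insert by (intro finsum_addf) (auto simp: Pi_def)
  finally show ?case
    using insert by (simp add: Pi_def)
qed

section \<open>The nonunital ring on \<Delta> and the circle operation\<close>

locale pair_ring = ring R for R :: "('r, 'm) ring_scheme" (structure) +
  fixes \<Delta> :: "('i \<times> 'i) set"
  assumes irrefl: "(i, i) \<notin> \<Delta>"
    and A2: "axiom_A2 \<Delta>"
begin

abbreviation "M \<equiv> span_mult R \<Delta>"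

abbreviation "FS \<equiv> free_span R"

lemma A2D:
  assumes "(i, j) \<in> \<Delta>" "(j, k) \<in> \<Delta>" "(k, l) \<in> \<Delta>" "(i, l) \<in> \<Delta>"
  shows "(i, k) \<in> \<Delta> \<longleftrightarrow> (j, l) \<in> \<Delta>"
  using A2 assms unfolding axiom_A2_def by blast

lemma FS_carrier: "x \<in> FS T \<Longrightarrow> x p \<in> carrier R"
  by (cases p) (simp add: free_span_def)

lemma FS_finite: "x \<in> FS T \<Longrightarrow> finite {p. x p \<noteq> \<zero>}"
  by (simp add: free_span_def)

lemma FS_outside: "x \<in> FS T \<Longrightarrow> p \<notin> T \<Longrightarrow> x p = \<zero>"
  by (cases p) (simp add: free_span_def)

lemma FS_restrict: "x \<in> FS T \<Longrightarrow> (\<And>p. p \<in> T \<Longrightarrow> p \<notin> T' \<Longrightarrow> x p = \<zero>) \<Longrightarrow> x \<in> FS T'"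
  unfolding free_span_def by blast

lemma FS_mono: "x \<in> FS T \<Longrightarrow> T \<subseteq> T' \<Longrightarrow> x \<in> FS T'"
  by (erule FS_restrict) blast

lemma zero_FS [simp]: "(\<lambda>_. \<zero>) \<in> FS T"
  by (simp add: free_span_def)

lemma monomial_FS: "a \<in> carrier R \<Longrightarrow> p \<in> T \<Longrightarrow> monomial R a p \<in> FS T"
  unfolding free_span_def monomial_def
  by (auto intro: finite_subset[of _ "{p}"])

text \<open>Up to truncation to \<Delta> this is a matrix product, because a pair \<open>p\<close>
  with first index \<open>i\<close> composes with just one \<open>q\<close> to give
  \<open>(i, l)\<close>. The finite set \<open>V\<close> may be any that covers the second indices
  in the support of \<open>x\<close>, so that several products can be expanded over a common
  range.\<close>

lemma M_eq:
  assumes x: "x \<in> FS T" and y: "y \<in> FS T'" and V: "finite V" "snd ` {p. x p \<noteq> \<zero>} \<subseteq> V"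
  shows "M x y (i, l) = (if (i, l) \<in> \<Delta> then \<Oplus>j\<in>V. x (i, j) \<otimes> y (j, l) else \<zero>)"
proof (cases "(i, l) \<in> \<Delta>")
  case False
  then have "monomial_mult R \<Delta> (x p) p (y q) q (i, l) = \<zero>" for p q
    by (auto simp: monomial_mult_def monomial_def split: prod.splits)
  then show ?thesis using False by (simp add: span_mult_def)
next
  case True
  note c = FS_carrier[OF x] FS_carrier[OF y]
  have inner: "(\<Oplus>q\<in>{q. y q \<noteq> \<zero>}. monomial_mult R \<Delta> (x p) p (y q) q (i, l)) =
      (if fst p = i then x p \<otimes> y (snd p, l) else \<zero>)" for p
  proof -
    have "(\<Oplus>q\<in>{q. y q \<noteq> \<zero>}. monomial_mult R \<Delta> (x p) p (y q) q (i, l)) =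
      (\<Oplus>q\<in>{q. y q \<noteq> \<zero>}. if q = (snd p, l) then (if fst p = i then x p \<otimes> y (snd p, l) else \<zero>) else \<zero>)"
      using True c by (intro finsum_cong')
        (auto simp: monomial_mult_def monomial_def split: prod.splits)
    \<comment> \<open>The side condition of \<open>finsum_single\<close> holds since
      \<open>y\<close> vanishes at \<open>(snd p, l)\<close> when that pair is outside its
      support.\<close>
    also have "\<dots> = (if fst p = i then x p \<otimes> y (snd p, l) else \<zero>)"
      using c FS_finite[OF y] by (intro finsum_single) auto
    finally show ?thesis .
  qed
  have "M x y (i, l) = (\<Oplus>p\<in>{p. x p \<noteq> \<zero>}. if fst p = i then x p \<otimes> y (snd p, l) else \<zero>)"
    by (simp add: span_mult_def inner)
  \<comment> \<open>Support entries of \<open>x\<close> in rows other than \<open>i\<close>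
    contribute zero, and so do the points of row \<open>i\<close> where \<open>x\<close>
    vanishes.\<close>
  also have "\<dots> = (\<Oplus>p\<in>Pair i ` V. x p \<otimes> y (snd p, l))"
    using V FS_finite[OF x] c
    by (intro add.finprod_mono_neutral_cong) force+
  also have "\<dots> = (\<Oplus>j\<in>V. x (i, j) \<otimes> y (j, l))"
    using c by (subst finsum_reindex) (auto simp: inj_on_def)
  finally show ?thesis using True by simp
qed

lemma M_support:
  assumes "x \<in> FS T" "y \<in> FS T'" "M x y (i, l) \<noteq> \<zero>"
  shows "(i, l) \<in> \<Delta>" "\<exists>j. x (i, j) \<noteq> \<zero> \<and> y (j, l) \<noteq> \<zero>"
proof -
  let ?V = "snd ` {p. x p \<noteq> \<zero>}"
  note eq = M_eq[OF assms(1,2) finite_imageI[OF FS_finite[OF assms(1)]] order_refl, of i l]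
  show il: "(i, l) \<in> \<Delta>" using eq assms(3) by (auto split: if_splits)
  show "\<exists>j. x (i, j) \<noteq> \<zero> \<and> y (j, l) \<noteq> \<zero>"
  proof (rule ccontr)
    assume *: "\<nexists>j. x (i, j) \<noteq> \<zero> \<and> y (j, l) \<noteq> \<zero>"
    have "x (i, j) \<otimes> y (j, l) = \<zero>" for j
      using * FS_carrier[OF assms(1), of "(i, j)"] FS_carrier[OF assms(2), of "(j, l)"]
      by (cases "x (i, j) = \<zero>") auto
    then show False using eq assms(3) il by simp
  qed
qed

lemma M_carrier [simp]:
  assumes "x \<in> FS T" "y \<in> FS T'"
  shows "M x y p \<in> carrier R"
  using M_eq[OF assms finite_imageI[OF FS_finite[OF assms(1)]] order_refl, of "fst p" "snd p"]
    FS_carrier[OF assms(1)] FS_carrier[OF assms(2)]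
  by (auto intro!: finsum_closed)

text \<open>A nonzero coefficient of the product sits at a composite of two support pairs. Its first
  index then comes from \<open>x\<close> and its second from \<open>y\<close>, which gives
  finiteness; what remains to check is a condition on index pairs.\<close>

lemma M_FS:
  assumes x: "x \<in> FS T" and y: "y \<in> FS T'"
    and "\<And>i j l. x (i, j) \<noteq> \<zero> \<Longrightarrow> y (j, l) \<noteq> \<zero> \<Longrightarrow> (i, l) \<in> \<Delta> \<Longrightarrow> (i, l) \<in> S"
  shows "M x y \<in> FS S"
proof -
  have "{p. M x y p \<noteq> \<zero>} \<subseteq> fst ` {p. x p \<noteq> \<zero>} \<times> snd ` {p. y p \<noteq> \<zero>}"
    using M_support[OF x y] by force
  then have "finite {p. M x y p \<noteq> \<zero>}"
    using FS_finite[OF x] FS_finite[OF y] finite_subset by fastforce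
  moreover have "M x y p = \<zero>" if "p \<notin> S" for p
    using M_support[OF x y, of "fst p" "snd p"] assms(3) that by fastforce
  ultimately show ?thesis
    using x y by (auto simp: free_span_def[of R S])
qed

definition fadd where "fadd x y = (\<lambda>p. x p \<oplus> y p)"

lemma fadd_FS:
  assumes "x \<in> FS T" "y \<in> FS T"
  shows "fadd x y \<in> FS T"
proof -
  have "{p. fadd x y p \<noteq> \<zero>} \<subseteq> {p. x p \<noteq> \<zero>} \<union> {p. y p \<noteq> \<zero>}"
    using assms by (auto simp: fadd_def)
  then have "finite {p. fadd x y p \<noteq> \<zero>}"
    using FS_finite[OF assms(1)] FS_finite[OF assms(2)] finite_subset by fastforce
  then show ?thesis
    using assms by (auto simp: free_span_def fadd_def)
qed

lemma M_add_left:
  assumes "x \<in> FS T" "y \<in> FS T" "z \<in> FS T"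
  shows "M (fadd x y) z p = M x z p \<oplus> M y z p"
proof -
  obtain i l where p: "p = (i, l)" by force
  let ?V = "snd ` ({p. x p \<noteq> \<zero>} \<union> {p. y p \<noteq> \<zero>})"
  have V: "finite ?V" "snd ` {p. x p \<noteq> \<zero>} \<subseteq> ?V" "snd ` {p. y p \<noteq> \<zero>} \<subseteq> ?V"
    "snd ` {p. fadd x y p \<noteq> \<zero>} \<subseteq> ?V"
    using FS_finite assms by (auto simp: fadd_def)
  note c = FS_carrier[OF assms(1)] FS_carrier[OF assms(2)] FS_carrier[OF assms(3)]
  show ?thesis
    unfolding p M_eq[OF assms(1,3) V(1,2)] M_eq[OF assms(2,3) V(1,3)]
      M_eq[OF fadd_FS[OF assms(1,2)] assms(3) V(1,4)]
    using c by (auto simp: fadd_def l_distr Pi_def)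
qed

lemma M_add_right:
  assumes "x \<in> FS T" "y \<in> FS T" "z \<in> FS T"
  shows "M x (fadd y z) p = M x y p \<oplus> M x z p"
proof -
  obtain i l where p: "p = (i, l)" by force
  note V = finite_imageI[OF FS_finite[OF assms(1)], of snd] order_refl
  note c = FS_carrier[OF assms(1)] FS_carrier[OF assms(2)] FS_carrier[OF assms(3)]
  show ?thesis
    unfolding p M_eq[OF assms(1,3) V] M_eq[OF assms(1,2) V]
      M_eq[OF assms(1) fadd_FS[OF assms(2,3)] V]
    using c by (auto simp: fadd_def r_distr Pi_def)
qed

text \<open>Both sides sum the terms \<open>x (i, j) y (j, k) z (k, l)\<close> over \<open>j\<close>
  and \<open>k\<close>. The left bracketing keeps those with \<open>(i, k)\<close> in \<Delta>, the
  right one those with \<open>(j, l)\<close> in \<Delta>; by (A2) the two conditions agree wherever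
  all three coefficients can be nonzero.\<close>

lemma M_assoc:
  assumes x: "x \<in> FS \<Delta>" and y: "y \<in> FS \<Delta>" and z: "z \<in> FS \<Delta>"
  shows "M (M x y) z p = M x (M y z) p"
proof -
  obtain i l where p: "p = (i, l)" by force
  \<comment> \<open>The second indices of \<open>x\<close> bound \<open>j\<close>, those of
    \<open>y\<close> bound \<open>k\<close>, and the support of \<open>M x y\<close> brings no new
    ones.\<close>
  let ?V = "snd ` ({p. x p \<noteq> \<zero>} \<union> {p. y p \<noteq> \<zero>})"
  note c [simp] = FS_carrier[OF x] FS_carrier[OF y] FS_carrier[OF z]
  have xy: "M x y \<in> FS \<Delta>" and yz: "M y z \<in> FS \<Delta>"
    using x y z by (auto intro!: M_FS)
  have fin: "finite ?V" using FS_finite[OF x] FS_finite[OF y] by simp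
  have "snd ` {p. M x y p \<noteq> \<zero>} \<subseteq> ?V"
    using M_support[OF x y] by force
  note e = M_eq[OF x y fin] M_eq[OF y z fin] M_eq[OF xy z fin this] M_eq[OF x yz fin]
  show ?thesis
  proof (cases "(i, l) \<in> \<Delta>")
    case False
    then show ?thesis by (simp add: p e image_mono)
  next
    case True
    have "M (M x y) z p = (\<Oplus>k\<in>?V. \<Oplus>j\<in>?V. if (i, k) \<in> \<Delta> then x (i, j) \<otimes> y (j, k) \<otimes> z (k, l) else \<zero>)"
      unfolding p e(3) using True fin
      by (auto simp: e image_mono finsum_ldistr Pi_def intro!: finsum_cong')
    also have "\<dots> = (\<Oplus>k\<in>?V. \<Oplus>j\<in>?V. if (j, l) \<in> \<Delta> then x (i, j) \<otimes> (y (j, k) \<otimes> z (k, l)) else \<zero>)"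
    proof (intro finsum_cong' refl)
      fix j k
      show "(if (i, k) \<in> \<Delta> then x (i, j) \<otimes> y (j, k) \<otimes> z (k, l) else \<zero>) =
            (if (j, l) \<in> \<Delta> then x (i, j) \<otimes> (y (j, k) \<otimes> z (k, l)) else \<zero>)"
      proof (cases "(i, j) \<in> \<Delta> \<and> (j, k) \<in> \<Delta> \<and> (k, l) \<in> \<Delta>")
        case True
        then show ?thesis using A2D[of i j k l] \<open>(i, l) \<in> \<Delta>\<close> by (auto simp: m_assoc)
      next
        case False
        then have "x (i, j) = \<zero> \<or> y (j, k) = \<zero> \<or> z (k, l) = \<zero>"
          using FS_outside x y z by blast
        then show ?thesis by auto
      qed
    qed (auto intro!: finsum_closed)
    also have "\<dots> = (\<Oplus>j\<in>?V. \<Oplus>k\<in>?V. if (j, l) \<in> \<Delta> then x (i, j) \<otimes> (y (j, k) \<otimes> z (k, l)) else \<zero>)"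
      using fin by (intro finsum_swap) auto
    also have "\<dots> = M x (M y z) p"
      unfolding p using True fin
      by (auto simp: e image_mono finsum_rdistr Pi_def intro!: finsum_cong')
    finally show ?thesis .
  qed
qed

text \<open>\<open>(1 + x) (1 + y) = 1 + circ x y\<close>.\<close>

definition circ where "circ x y = (\<lambda>p. x p \<oplus> y p \<oplus> M x y p)"

lemma circ_fadd: "circ x y = fadd (fadd x y) (M x y)"
  by (simp add: circ_def fadd_def)

lemma circ_assoc:
  assumes x: "x \<in> FS \<Delta>" and y: "y \<in> FS \<Delta>" and z: "z \<in> FS \<Delta>"
  shows "circ (circ x y) z = circ x (circ y z)"
proof
  fix p
  have M_in: "M u v \<in> FS \<Delta>" if "u \<in> FS \<Delta>" "v \<in> FS \<Delta>" for u v
    using that by (intro M_FS)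
  note in_FS = assms M_in fadd_FS
  have c: "x p \<in> carrier R" "y p \<in> carrier R" "z p \<in> carrier R"
    "M x y p \<in> carrier R" "M x z p \<in> carrier R" "M y z p \<in> carrier R"
    "M x (M y z) p \<in> carrier R"
    by (auto intro!: FS_carrier[where T = \<Delta>] in_FS)
  have "M (circ x y) z p = M x z p \<oplus> M y z p \<oplus> M x (M y z) p"
    by (simp add: circ_fadd M_add_left[where T = \<Delta>] in_FS M_assoc)
  moreover have "M x (circ y z) p = M x y p \<oplus> M x z p \<oplus> M x (M y z) p"
    by (simp add: circ_fadd M_add_right[where T = \<Delta>] in_FS)
  ultimately show "circ (circ x y) z p = circ x (circ y z) p"
    using c by (simp add: circ_def[of "circ x y"] circ_def[of x "circ y z"])
      (simp add: circ_def a_ac)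
qed

lemma circ_zero_left [simp]: "x \<in> FS T \<Longrightarrow> circ (\<lambda>_. \<zero>) x = x"
  using M_support[OF zero_FS, of x T] FS_carrier[of x T] by (fastforce simp: circ_def)

lemma closed_subsetD:
  "closed_subset \<Delta> T \<Longrightarrow> (i, j) \<in> T \<Longrightarrow> (j, k) \<in> T \<Longrightarrow> (i, k) \<in> \<Delta> \<Longrightarrow> (i, k) \<in> T"
  unfolding closed_subset_def by blast

lemma closed_subset_sub: "closed_subset \<Delta> T \<Longrightarrow> T \<subseteq> \<Delta>"
  unfolding closed_subset_def by blast

lemma FS_nonzeroD: "x \<in> FS T \<Longrightarrow> x p \<noteq> \<zero> \<Longrightarrow> p \<in> T"
  using FS_outside by blast

lemma circ_FS:
  assumes "closed_subset \<Delta> T" "x \<in> FS T" "y \<in> FS T"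
  shows "circ x y \<in> FS T"
proof -
  have "M x y \<in> FS T"
    using assms by (intro M_FS) (auto intro: closed_subsetD dest: FS_nonzeroD)
  then show ?thesis using assms by (simp add: circ_fadd fadd_FS)
qed

lemma M_monomial_left:
  assumes "a \<in> carrier R" "x \<in> FS T"
  shows "M (monomial R a (i, m)) x (i', l) = (if (i', l) \<in> \<Delta> \<and> i' = i then a \<otimes> x (m, l) else \<zero>)"
  using assms FS_carrier[OF assms(2)]
  by (subst M_eq[OF monomial_FS[where T = UNIV] assms(2), of _ _ "{m}"])
    (auto simp: monomial_def)

text \<open>The two indices of \<open>p\<close> differ, so \<open>e_p e_p = 0\<close> and the
  factors \<open>1 + a e_p\<close> and \<open>1 - a e_p\<close> cancel.\<close>

lemma circ_monomial_cancel:
  assumes "a \<in> carrier R" "p \<in> \<Delta>" "x \<in> FS \<Delta>"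
  shows "circ (monomial R a p) (circ (monomial R (\<ominus> a) p) x) = x"
proof -
  obtain i m where p: "p = (i, m)" by force
  have "m \<noteq> i" using irrefl assms p by blast
  have "circ (monomial R a p) (monomial R (\<ominus> a) p) q = \<zero>" for q
    using assms \<open>m \<noteq> i\<close> unfolding circ_def p
    by (cases q) (simp add: M_monomial_left[OF _ monomial_FS[where T = UNIV]], simp add: monomial_def r_neg)
  then have "circ (monomial R a p) (monomial R (\<ominus> a) p) = (\<lambda>_. \<zero>)" by blast
  then show ?thesis
    using assms by (simp flip: circ_assoc add: monomial_FS)
qed

section \<open>Indecomposable pairs and induction over closed index sets\<close>

definition mids where "mids T p = {m. (fst p, m) \<in> T \<and> (m, snd p) \<in> T}"

text \<open>Passing from a pair to a factor of it strictly decreases the set of intermediate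
  points, so a pair with the fewest of them does not factor at all.\<close>

lemma exists_indecomposable:
  assumes T: "closed_subset \<Delta> T" "finite T" "T \<noteq> {}"
  obtains p where "p \<in> T" "mids T p = {}"
proof -
  define p where "p = arg_min_on (card \<circ> mids T) T"
  have p: "p \<in> T" "\<And>q. q \<in> T \<Longrightarrow> card (mids T p) \<le> card (mids T q)"
    using arg_min_if_finite(1)[OF T(2,3), of "card \<circ> mids T"]
      arg_min_least[OF T(2,3), of _ "card \<circ> mids T"]
    unfolding p_def by simp_all
  obtain i j where ij: "p = (i, j)" by force
  have "mids T p = {}"
  proof (rule ccontr)
    assume "mids T p \<noteq> {}"
    then obtain m where m: "(i, m) \<in> T" "(m, j) \<in> T" by (auto simp: mids_def ij)
    note sub = closed_subset_sub[OF T(1)]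
    have "n \<in> mids T p" if "n \<in> mids T (i, m)" for n
    proof -
      have n: "(i, n) \<in> T" "(n, m) \<in> T" using that by (auto simp: mids_def)
      \<comment> \<open>(A2) is applied to the chain \<open>i, n, m, j\<close>, where
        \<open>(i, m)\<close> is known to lie in \<Delta>; closedness then puts
        \<open>(n, j)\<close> into \<open>T\<close>.\<close>
      then have "(n, j) \<in> \<Delta>" using A2D[of i n m j] m p(1) ij sub by blast
      then show ?thesis using closed_subsetD[OF T(1) n(2) m(2)] n by (simp add: mids_def ij)
    qed
    \<comment> \<open>The inclusion is strict because \<open>m\<close> could lie in
      \<open>mids T (i, m)\<close> only if \<open>(m, m)\<close> were in \<Delta>.\<close>
    moreover have "m \<in> mids T p" "m \<notin> mids T (i, m)"
      using m irrefl sub by (auto simp: mids_def ij)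
    ultimately have "mids T (i, m) \<subset> mids T p" by blast
    moreover have "finite (mids T p)"
      by (rule finite_subset[of _ "fst ` T"]) (use T(2) in \<open>force simp: mids_def\<close>)+
    ultimately have "card (mids T (i, m)) < card (mids T p)" by (intro psubset_card_mono)
    then show False using p(2)[OF m(1)] by simp
  qed
  then show ?thesis using that p by blast
qed

text \<open>Removing \<open>p\<close> can break closedness only at a composite equal to
  \<open>p\<close>, and an empty \<open>mids T p\<close> excludes that.\<close>

lemma closed_subset_Diff_indecomposable:
  assumes "closed_subset \<Delta> T" "mids T p = {}"
  shows "closed_subset \<Delta> (T - {p})"
  using assms unfolding closed_subset_def mids_def by fastforce

text \<open>Removing an indecomposable pair leaves a smaller closed set, so the induction runs over
  \<open>card T\<close>; the factor taken off is restored by one use of \<open>step\<close>.\<close>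

lemma circ_induct_finite:
  assumes "finite T" "closed_subset \<Delta> T" "x \<in> FS T"
    and zero: "P (\<lambda>_. \<zero>)"
    and step: "\<And>p a y. p \<in> T \<Longrightarrow> a \<in> carrier R \<Longrightarrow> y \<in> FS T \<Longrightarrow> P y \<Longrightarrow> P (circ (monomial R a p) y)"
  shows "P x"
  using assms
proof (induction "card T" arbitrary: T x)
  case 0
  then have "T = {}" by simp
  then have "x = (\<lambda>_. \<zero>)" using FS_outside[OF 0(4)] by blast
  then show ?case using 0 by simp
next
  case (Suc n)
  then have "T \<noteq> {}" by auto
  then obtain p where p: "p \<in> T" "mids T p = {}"
    using exists_indecomposable Suc by blast
  obtain i j where ij: "p = (i, j)" by force
  note sub = closed_subset_sub[OF Suc.prems(2)]
  note x = Suc.prems(3)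
  have x_in: "x p \<in> carrier R" using FS_carrier[OF x] .
  have "i \<noteq> j" using p(1) ij sub irrefl by blast
  define y where "y = circ (monomial R (\<ominus> x p) p) x"
  have "y \<in> FS T"
    unfolding y_def using Suc.prems x_in p by (intro circ_FS monomial_FS) auto
  moreover have "y p = \<zero>"
  proof -
    \<comment> \<open>At \<open>p\<close> the product contributes \<open>- x p\<close> times
      \<open>x (j, j)\<close>; as this vanishes, only \<open>- x p + x p\<close> is left.\<close>
    have "x (j, j) = \<zero>" using FS_outside[OF x, of "(j, j)"] irrefl sub by blast
    then show ?thesis
      using x_in unfolding y_def circ_def ij
      by (subst M_monomial_left[OF _ x]) (auto simp: monomial_def l_neg)
  qed
  ultimately have y: "y \<in> FS (T - {p})" by (auto intro: FS_restrict)
  have "P y"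
  proof (rule Suc.hyps(1)[of "T - {p}"])
    show "n = card (T - {p})" using Suc.hyps(2) Suc.prems(1) p by simp
    show "closed_subset \<Delta> (T - {p})"
      using closed_subset_Diff_indecomposable Suc.prems p by blast
    show "P (circ (monomial R a q) z)"
      if "q \<in> T - {p}" "a \<in> carrier R" "z \<in> FS (T - {p})" "P z" for q a z
      using Suc.prems(5)[of q a z] that FS_mono[of z "T - {p}" T] by blast
  qed (use Suc.prems y in auto)
  then have "P (circ (monomial R (x p) p) y)"
    using Suc.prems(5) p(1) x_in \<open>y \<in> FS T\<close> by blast
  also have "circ (monomial R (x p) p) y = x"
    unfolding y_def using circ_monomial_cancel x_in p(1) sub FS_mono[OF x sub] by blast
  finally show ?case .
qed

text \<open>For infinite \<open>T\<close> it suffices to work inside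
  \<open>T \<inter> V \<times> V\<close>, where \<open>V\<close> is the finite set of indices met by
  the support of \<open>x\<close>. This set is again closed, as composing pairs introduces no new
  index.\<close>

lemma circ_induct [consumes 2, case_names zero step]:
  assumes T: "closed_subset \<Delta> T" and x: "x \<in> FS T"
    and zero: "P (\<lambda>_. \<zero>)"
    and step: "\<And>p a y. p \<in> T \<Longrightarrow> a \<in> carrier R \<Longrightarrow> y \<in> FS T \<Longrightarrow> P y \<Longrightarrow> P (circ (monomial R a p) y)"
  shows "P x"
proof -
  define V where "V = fst ` {p. x p \<noteq> \<zero>} \<union> snd ` {p. x p \<noteq> \<zero>}"
  let ?T = "T \<inter> V \<times> V"
  have "finite ?T" using FS_finite[OF x] by (simp add: V_def)
  moreover have "closed_subset \<Delta> ?T"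
    using T unfolding closed_subset_def by blast
  moreover have "x \<in> FS ?T"
    using x by (rule FS_restrict) (force simp: V_def)
  ultimately show ?thesis
    using zero
  proof (rule circ_induct_finite)
    fix p a y
    assume "p \<in> ?T" "a \<in> carrier R" "y \<in> FS ?T" "P y"
    then show "P (circ (monomial R a p) y)"
      using step[of p a y] FS_mono[of y ?T T] by blast
  qed
qed

text \<open>The inverse is assembled factor by factor: if \<open>1 + y\<close> is a left inverse of
  \<open>1 + x\<close>, then \<open>(1 + y) (1 - a e_p)\<close> is one of
  \<open>(1 + a e_p) (1 + x)\<close>.\<close>

lemma circ_left_inverse:
  assumes T: "closed_subset \<Delta> T" and x: "x \<in> FS T"
  shows "\<exists>y\<in>FS T. circ y x = (\<lambda>_. \<zero>)"
  using assms
proof (induction rule: circ_induct)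
  case zero
  show ?case by (rule bexI[of _ "\<lambda>_. \<zero>"]) (auto intro: circ_zero_left[where T = T])
next
  case (step p a x)
  then obtain y where y: "y \<in> FS T" "circ y x = (\<lambda>_. \<zero>)" by blast
  note sub = closed_subset_sub[OF T]
  have m: "monomial R a p \<in> FS T" "monomial R (\<ominus> a) p \<in> FS T"
    using step by (auto intro: monomial_FS)
  note in_D = FS_mono[OF _ sub]
  \<comment> \<open>Writing \<open>a\<close> as \<open>\<ominus> (\<ominus> a)\<close> brings the
    middle factors into the shape of \<open>circ_monomial_cancel\<close> for
    \<open>\<ominus> a\<close>.\<close>
  have "circ (circ y (monomial R (\<ominus> a) p)) (circ (monomial R a p) x) =
      circ y (circ (monomial R (\<ominus> a) p) (circ (monomial R (\<ominus> (\<ominus> a)) p) x))"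
    using step in_D[OF y(1)] in_D[OF m(1)] in_D[OF m(2)] in_D[OF step(3)]
      circ_FS[OF T m(1) step(3), THEN in_D]
    by (simp add: circ_assoc)
  also have "\<dots> = (\<lambda>_. \<zero>)"
    using circ_monomial_cancel[of "\<ominus> a" p x] step in_D[OF step(3)] sub y by auto
  finally show ?case using circ_FS[OF T y(1) m(2)] by blast
qed

section \<open>The unipotent groups and their elementary commutators\<close>

abbreviation "U \<equiv> unip_group R \<Delta>"

lemma carrier_U: "carrier (U T) = Pair \<one> ` FS T"
  by (auto simp: unip_group_def)

lemma mult_U:
  assumes "x \<in> FS T" "y \<in> FS T"
  shows "(\<one>, x) \<otimes>\<^bsub>U S\<^esub> (\<one>, y) = (\<one>, circ x y)"
  using FS_carrier[OF assms(1)] FS_carrier[OF assms(2)] M_carrier[OF assms]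
  by (simp add: unip_group_def units_of_def unital_ext_def circ_def a_comm)

lemma one_U: "\<one>\<^bsub>U T\<^esub> = (\<one>, \<lambda>_. \<zero>)"
  by (simp add: unip_group_def units_of_def unital_ext_def)

text \<open>All these groups share one multiplication and unit and differ in the carrier alone. A
  term of the central series, given as a subset of \<open>U \<Gamma>\<close>, can thus be treated as
  a group \<open>U T\<close> of its own.\<close>

lemma U_carrier_update: "(U T)\<lparr>carrier := carrier (U S)\<rparr> = U S"
  by (simp add: unip_group_def)

lemma group_U:
  assumes T: "closed_subset \<Delta> T"
  shows "group (U T)"
proof (rule groupI)
  note in_D = FS_mono[OF _ closed_subset_sub[OF T]]
  fix g assume "g \<in> carrier (U T)"
  then obtain x where x: "g = (\<one>, x)" "x \<in> FS T" by (auto simp: carrier_U)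
  show "\<one>\<^bsub>U T\<^esub> \<otimes>\<^bsub>U T\<^esub> g = g"
    using x by (simp add: one_U mult_U[where T = T])
  obtain y where "y \<in> FS T" "circ y x = (\<lambda>_. \<zero>)"
    using circ_left_inverse[OF T x(2)] by blast
  then show "\<exists>h\<in>carrier (U T). h \<otimes>\<^bsub>U T\<^esub> g = \<one>\<^bsub>U T\<^esub>"
    using x by (auto simp: carrier_U one_U mult_U[where T = T] intro!: bexI[of _ y])
  fix h assume "h \<in> carrier (U T)"
  then obtain y where y: "h = (\<one>, y)" "y \<in> FS T" by (auto simp: carrier_U)
  show "g \<otimes>\<^bsub>U T\<^esub> h \<in> carrier (U T)"
    using x y circ_FS[OF T] by (simp add: carrier_U mult_U[where T = T])
  fix f assume "f \<in> carrier (U T)"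
  then obtain z where z: "f = (\<one>, z)" "z \<in> FS T" by (auto simp: carrier_U)
  show "g \<otimes>\<^bsub>U T\<^esub> h \<otimes>\<^bsub>U T\<^esub> f = g \<otimes>\<^bsub>U T\<^esub> (h \<otimes>\<^bsub>U T\<^esub> f)"
    using x y z circ_FS[OF T] circ_assoc in_D by (simp add: mult_U[where T = T])
qed (simp add: one_U carrier_U)

lemma subgroup_U:
  assumes "closed_subset \<Delta> T" "closed_subset \<Delta> S" "S \<subseteq> T"
  shows "subgroup (carrier (U S)) (U T)"
proof (rule group.group_incl_imp_subgroup[OF group_U[OF assms(1)]])
  show "carrier (U S) \<subseteq> carrier (U T)"
    using FS_mono[OF _ assms(3)] by (auto simp: carrier_U)
  show "group (U T\<lparr>carrier := carrier (U S)\<rparr>)"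
    using group_U[OF assms(2)] by (simp add: U_carrier_update)
qed

text \<open>Here \<open>e_jl e_ij = 0\<close> because \<open>l \<noteq> i\<close>, and
  \<open>e_il e_jl = e_il e_ij = 0\<close> because \<open>l\<close> differs from \<open>j\<close>
  and \<open>i\<close>; both sides are \<open>1 + b e_ij + c e_jl + bc e_il\<close>. The form
  \<open>xy = z(yx)\<close> keeps inverses out of the computation, and \<open>commutator_eqI\<close>
  puts them back.\<close>

lemma circ_monomial_commutator:
  assumes "b \<in> carrier R" "c \<in> carrier R" "(i, j) \<in> \<Delta>" "(j, l) \<in> \<Delta>" "(i, l) \<in> \<Delta>"
  shows "circ (monomial R b (i, j)) (monomial R c (j, l)) =
    circ (monomial R (b \<otimes> c) (i, l)) (circ (monomial R c (j, l)) (monomial R b (i, j)))"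
proof -
  have ne: "i \<noteq> j" "j \<noteq> l" "i \<noteq> l" using assms(3-5) irrefl by blast+
  note mono = monomial_FS[where T = UNIV]
  have YX: "circ (monomial R c (j, l)) (monomial R b (i, j)) =
      fadd (monomial R c (j, l)) (monomial R b (i, j))"
    using assms ne unfolding circ_def fadd_def
    by (intro ext, clarify, subst M_monomial_left[OF _ mono]) (auto simp: monomial_def)
  have FS: "fadd (monomial R c (j, l)) (monomial R b (i, j)) \<in> FS UNIV"
    using assms mono by (intro fadd_FS) auto
  show ?thesis
    unfolding YX unfolding circ_def
  proof (intro ext, clarify)
    fix s t
    show "monomial R b (i, j) (s, t) \<oplus> monomial R c (j, l) (s, t)
          \<oplus> M (monomial R b (i, j)) (monomial R c (j, l)) (s, t) =
        monomial R (b \<otimes> c) (i, l) (s, t)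
          \<oplus> fadd (monomial R c (j, l)) (monomial R b (i, j)) (s, t)
          \<oplus> M (monomial R (b \<otimes> c) (i, l)) (fadd (monomial R c (j, l)) (monomial R b (i, j))) (s, t)"
      using assms ne
      by (subst M_monomial_left[OF _ mono], simp, simp, simp,
          subst M_monomial_left[OF _ FS], simp) (auto simp: fadd_def monomial_def)
  qed
qed

end

section \<open>One step of the descending central series\<close>

lemma (in group) commutator_eqI:
  assumes "x \<in> carrier G" "y \<in> carrier G" "c \<in> carrier G" "x \<otimes> y = c \<otimes> (y \<otimes> x)"
  shows "x \<otimes> y \<otimes> inv x \<otimes> inv y = c"
proof -
  have "x \<otimes> y \<otimes> inv x \<otimes> inv y = x \<otimes> y \<otimes> inv (y \<otimes> x)"
    using assms(1-3) by (simp add: m_assoc inv_mult_group)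
  also have "\<dots> = c \<otimes> (y \<otimes> x) \<otimes> inv (y \<otimes> x)"
    by (simp only: assms(4))
  also have "\<dots> = c" using assms by (subst m_assoc) simp_all
  finally show ?thesis .
qed

text \<open>\<open>A\<close> stands for a term of the series of \<Gamma>. The last assumption makes
  the span of \<open>A\<close> a two-sided ideal in the span of \<Gamma>, which lets one step be
  treated without reference to \<open>k\<close>.\<close>

locale pair_ring_ideal = pair_ring R \<Delta> for R :: "('r, 'm) ring_scheme" (structure)
    and \<Delta> :: "('i \<times> 'i) set" +
  fixes \<Gamma> A :: "('i \<times> 'i) set"
  assumes \<Gamma>: "closed_subset \<Delta> \<Gamma>"
    and A_sub: "A \<subseteq> \<Gamma>"
    and bracket_sub: "index_bracket \<Delta> A \<Gamma> \<subseteq> A"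
begin

abbreviation "B \<equiv> index_bracket \<Delta> A \<Gamma>"

lemma bracketI1: "(i, j) \<in> A \<Longrightarrow> (j, l) \<in> \<Gamma> \<Longrightarrow> (i, l) \<in> \<Delta> \<Longrightarrow> (i, l) \<in> B"
  and bracketI2: "(i, j) \<in> \<Gamma> \<Longrightarrow> (j, l) \<in> A \<Longrightarrow> (i, l) \<in> \<Delta> \<Longrightarrow> (i, l) \<in> B"
  unfolding index_bracket_def by blast+

lemma closed_A: "closed_subset \<Delta> A"
  using closed_subset_sub[OF \<Gamma>] A_sub bracket_sub bracketI1
  unfolding closed_subset_def by blast

lemma closed_B: "closed_subset \<Delta> B"
  using closed_subset_sub[OF closed_A] A_sub bracket_sub bracketI1
  unfolding closed_subset_def by blast

lemma B_sub: "B \<subseteq> \<Gamma>"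
  using bracket_sub A_sub by blast

lemma M_zero_outside:
  assumes "x \<in> FS A" "y \<in> FS \<Gamma>" "p \<notin> B"
  shows "M x y p = \<zero>" "M y x p = \<zero>"
proof -
  have "M x y \<in> FS B" "M y x \<in> FS B"
    by (rule M_FS[OF assms(1,2)], metis FS_nonzeroD assms(1,2) bracketI1)
      (rule M_FS[OF assms(2,1)], metis FS_nonzeroD assms(1,2) bracketI2)
  then show "M x y p = \<zero>" "M y x p = \<zero>" using assms(3) FS_outside by blast+
qed

text \<open>Congruence modulo the span of \<open>B\<close>, expressed as agreement of coefficients
  off \<open>B\<close>, survives right multiplication by \<open>1 + w\<close>: coefficients differ
  only at pairs of \<open>B\<close>, and as \<open>B\<close> lies in \<open>A\<close>, composing
  such a pair with one of \<Gamma> leads into \<open>B\<close> again.\<close>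

lemma circ_cong_outside:
  assumes u: "u \<in> FS \<Gamma>" and v: "v \<in> FS \<Gamma>" and w: "w \<in> FS \<Gamma>"
    and eq: "\<And>p. p \<notin> B \<Longrightarrow> u p = v p" and p: "p \<notin> B"
  shows "circ u w p = circ v w p"
proof -
  obtain i l where il: "p = (i, l)" by force
  let ?V = "snd ` ({p. u p \<noteq> \<zero>} \<union> {p. v p \<noteq> \<zero>})"
  have V: "finite ?V" "snd ` {p. u p \<noteq> \<zero>} \<subseteq> ?V" "snd ` {p. v p \<noteq> \<zero>} \<subseteq> ?V"
    using FS_finite u v by auto
  note c = FS_carrier[OF u] FS_carrier[OF v] FS_carrier[OF w]
  have "u (i, j) \<otimes> w (j, l) = v (i, j) \<otimes> w (j, l)" if "(i, l) \<in> \<Delta>" for j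
  proof (cases "(i, j) \<in> B \<and> (j, l) \<in> \<Gamma>")
    case True
    then have "p \<in> B"
      using bracketI1 bracket_sub that il by blast
    then show ?thesis using p by blast
  next
    case False
    then have "u (i, j) = v (i, j) \<or> w (j, l) = \<zero>"
      using eq FS_outside[OF w] by blast
    then show ?thesis using c by auto
  qed
  then have "M u w p = M v w p"
    unfolding il M_eq[OF u w V(1,2)] M_eq[OF v w V(1,3)] by simp
  then show ?thesis using eq[OF p] by (simp add: circ_def)
qed

text \<open>The commutator is \<open>gh\<close> times the inverse of \<open>hg\<close>. As
  \<open>gh\<close> and \<open>hg\<close> agree off \<open>B\<close>, right multiplication of both
  by that inverse shows that the commutator agrees with \<open>1\<close> off
  \<open>B\<close>.\<close>

lemma commutator_in_B:
  assumes "g \<in> carrier (U A)" "h \<in> carrier (U \<Gamma>)"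
  shows "g \<otimes>\<^bsub>U \<Gamma>\<^esub> h \<otimes>\<^bsub>U \<Gamma>\<^esub> inv\<^bsub>U \<Gamma>\<^esub> g \<otimes>\<^bsub>U \<Gamma>\<^esub> inv\<^bsub>U \<Gamma>\<^esub> h \<in> carrier (U B)"
proof -
  interpret G: group "U \<Gamma>" by (rule group_U[OF \<Gamma>])
  obtain x y where x: "g = (\<one>, x)" "x \<in> FS A" and y: "h = (\<one>, y)" "y \<in> FS \<Gamma>"
    using assms by (auto simp: carrier_U)
  have x': "x \<in> FS \<Gamma>" using FS_mono[OF x(2) A_sub] .
  have gh: "g \<in> carrier (U \<Gamma>)" "h \<in> carrier (U \<Gamma>)" using x x' y by (auto simp: carrier_U)
  then have "inv\<^bsub>U \<Gamma>\<^esub> (h \<otimes>\<^bsub>U \<Gamma>\<^esub> g) \<in> carrier (U \<Gamma>)" by simp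
  then obtain w where w: "inv\<^bsub>U \<Gamma>\<^esub> (h \<otimes>\<^bsub>U \<Gamma>\<^esub> g) = (\<one>, w)" "w \<in> FS \<Gamma>"
    unfolding carrier_U by blast
  have xy: "circ x y \<in> FS \<Gamma>" and yx: "circ y x \<in> FS \<Gamma>"
    using circ_FS[OF \<Gamma>] x' y by auto
  have "(\<one>, circ (circ y x) w) = h \<otimes>\<^bsub>U \<Gamma>\<^esub> g \<otimes>\<^bsub>U \<Gamma>\<^esub> inv\<^bsub>U \<Gamma>\<^esub> (h \<otimes>\<^bsub>U \<Gamma>\<^esub> g)"
    unfolding w using x(1) y x' w(2) yx by (simp add: mult_U[where T = \<Gamma>])
  also have "\<dots> = (\<one>, \<lambda>_. \<zero>)" using gh by (simp add: one_U)
  finally have yxw: "circ (circ y x) w = (\<lambda>_. \<zero>)" by simp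
  have "circ (circ x y) w \<in> FS B"
  proof (rule FS_restrict[OF circ_FS[OF \<Gamma> xy w(2)]])
    fix p assume "p \<notin> B"
    have "circ x y q = circ y x q" if "q \<notin> B" for q
      using M_zero_outside[OF x(2) y(2) that] FS_carrier[OF x'] FS_carrier[OF y(2)]
      by (simp add: circ_def a_comm)
    then show "circ (circ x y) w p = \<zero>"
      using circ_cong_outside[OF xy yx w(2) _ \<open>p \<notin> B\<close>] yxw by simp
  qed
  moreover have "g \<otimes>\<^bsub>U \<Gamma>\<^esub> h \<otimes>\<^bsub>U \<Gamma>\<^esub> inv\<^bsub>U \<Gamma>\<^esub> g \<otimes>\<^bsub>U \<Gamma>\<^esub> inv\<^bsub>U \<Gamma>\<^esub> h =
      g \<otimes>\<^bsub>U \<Gamma>\<^esub> h \<otimes>\<^bsub>U \<Gamma>\<^esub> inv\<^bsub>U \<Gamma>\<^esub> (h \<otimes>\<^bsub>U \<Gamma>\<^esub> g)"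
    using gh by (simp add: G.inv_mult_group G.m_assoc)
  moreover have "\<dots> = (\<one>, circ (circ x y) w)"
    unfolding w using x(1) y x' w(2) xy by (simp add: mult_U[where T = \<Gamma>])
  ultimately show ?thesis by (simp add: carrier_U)
qed

lemma commutator_subgroup_U:
  "commutator_subgroup (U \<Gamma>) (carrier (U A)) (carrier (U \<Gamma>)) = carrier (U B)"
proof
  interpret G: group "U \<Gamma>" by (rule group_U[OF \<Gamma>])
  let ?C = "\<Union>a\<in>carrier (U A). \<Union>b\<in>carrier (U \<Gamma>).
    {a \<otimes>\<^bsub>U \<Gamma>\<^esub> b \<otimes>\<^bsub>U \<Gamma>\<^esub> inv\<^bsub>U \<Gamma>\<^esub> a \<otimes>\<^bsub>U \<Gamma>\<^esub> inv\<^bsub>U \<Gamma>\<^esub> b}"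
  show "commutator_subgroup (U \<Gamma>) (carrier (U A)) (carrier (U \<Gamma>)) \<subseteq> carrier (U B)"
    unfolding commutator_subgroup_def
    by (rule G.generate_subgroup_incl[OF _ subgroup_U[OF \<Gamma> closed_B B_sub]])
      (use commutator_in_B in blast)
  have elem: "(\<one>, monomial R a p) \<in> generate (U \<Gamma>) ?C"
    if p: "p \<in> B" and a: "a \<in> carrier R" for p a
  proof -
    obtain i l where il: "p = (i, l)" by force
    then have "(i, l) \<in> \<Delta>" using p closed_subset_sub[OF closed_B] by blast
    have key: "(\<one>, monomial R b (i, j)) \<otimes>\<^bsub>U \<Gamma>\<^esub> (\<one>, monomial R c (j, l)) =
        (\<one>, monomial R (b \<otimes> c) p) \<otimes>\<^bsub>U \<Gamma>\<^esub> ((\<one>, monomial R c (j, l)) \<otimes>\<^bsub>U \<Gamma>\<^esub> (\<one>, monomial R b (i, j)))"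
      "(\<one>, monomial R b (i, j)) \<in> carrier (U \<Gamma>)" "(\<one>, monomial R c (j, l)) \<in> carrier (U \<Gamma>)"
      "(\<one>, monomial R (b \<otimes> c) p) \<in> carrier (U \<Gamma>)"
      if "b \<in> carrier R" "c \<in> carrier R" "(i, j) \<in> \<Gamma>" "(j, l) \<in> \<Gamma>" for b c j
    proof -
      have m: "monomial R b (i, j) \<in> FS \<Gamma>" "monomial R c (j, l) \<in> FS \<Gamma>"
        "monomial R (b \<otimes> c) (i, l) \<in> FS \<Gamma>"
        using that p il B_sub by (auto intro!: monomial_FS)
      then show "(\<one>, monomial R b (i, j)) \<in> carrier (U \<Gamma>)" "(\<one>, monomial R c (j, l)) \<in> carrier (U \<Gamma>)"
        "(\<one>, monomial R (b \<otimes> c) p) \<in> carrier (U \<Gamma>)"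
        by (auto simp: carrier_U il)
      have "(i, j) \<in> \<Delta>" "(j, l) \<in> \<Delta>" using that closed_subset_sub[OF \<Gamma>] by auto
      then show "(\<one>, monomial R b (i, j)) \<otimes>\<^bsub>U \<Gamma>\<^esub> (\<one>, monomial R c (j, l)) =
        (\<one>, monomial R (b \<otimes> c) p) \<otimes>\<^bsub>U \<Gamma>\<^esub> ((\<one>, monomial R c (j, l)) \<otimes>\<^bsub>U \<Gamma>\<^esub> (\<one>, monomial R b (i, j)))"
        using circ_monomial_commutator[of b c i j l] that \<open>(i, l) \<in> \<Delta>\<close> m
          circ_FS[OF \<Gamma> m(2,1)]
        by (simp add: mult_U[where T = \<Gamma>] il)
    qed
    \<comment> \<open>In the factorisation of \<open>p\<close> the pair from \<open>A\<close> comes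
      first or second. The other pair is given coefficient \<open>1\<close>, so that the commutator
      has coefficient exactly \<open>a\<close>.\<close>
    consider (left) j where "(i, j) \<in> A" "(j, l) \<in> \<Gamma>" | (right) j where "(i, j) \<in> \<Gamma>" "(j, l) \<in> A"
      using p unfolding il index_bracket_def by blast
    then show ?thesis
    proof cases
      case left
      note k = key[OF a one_closed subsetD[OF A_sub left(1)] left(2)]
      have "(\<one>, monomial R a (i, j)) \<in> carrier (U A)"
        using left a by (auto simp: carrier_U intro!: monomial_FS)
      then have "(\<one>, monomial R (a \<otimes> \<one>) p) \<in> ?C"
        unfolding G.commutator_eqI[OF k(2-4,1), symmetric] using k(3) by blast
      then show ?thesis using a by (auto intro: generate.incl)
    next
      case right
      note k = key[OF one_closed a right(1) subsetD[OF A_sub right(2)]]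
      \<comment> \<open>Now the element of \<open>U A\<close> is the second entry of the wanted
        commutator, while in \<open>?C\<close> it is the first; the commutator is therefore reached
        as the inverse of a member of \<open>?C\<close>.\<close>
      let ?x = "(\<one>, monomial R \<one> (i, j))" and ?y = "(\<one>, monomial R a (j, l))"
      have "?y \<in> carrier (U A)"
        using right a by (auto simp: carrier_U intro!: monomial_FS)
      then have "?y \<otimes>\<^bsub>U \<Gamma>\<^esub> ?x \<otimes>\<^bsub>U \<Gamma>\<^esub> inv\<^bsub>U \<Gamma>\<^esub> ?y \<otimes>\<^bsub>U \<Gamma>\<^esub> inv\<^bsub>U \<Gamma>\<^esub> ?x \<in> ?C"
        using k(2) by blast
      then have "inv\<^bsub>U \<Gamma>\<^esub> (?y \<otimes>\<^bsub>U \<Gamma>\<^esub> ?x \<otimes>\<^bsub>U \<Gamma>\<^esub> inv\<^bsub>U \<Gamma>\<^esub> ?y \<otimes>\<^bsub>U \<Gamma>\<^esub> inv\<^bsub>U \<Gamma>\<^esub> ?x) \<in> generate (U \<Gamma>) ?C"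
        by (rule generate.inv)
      also have "inv\<^bsub>U \<Gamma>\<^esub> (?y \<otimes>\<^bsub>U \<Gamma>\<^esub> ?x \<otimes>\<^bsub>U \<Gamma>\<^esub> inv\<^bsub>U \<Gamma>\<^esub> ?y \<otimes>\<^bsub>U \<Gamma>\<^esub> inv\<^bsub>U \<Gamma>\<^esub> ?x) =
          ?x \<otimes>\<^bsub>U \<Gamma>\<^esub> ?y \<otimes>\<^bsub>U \<Gamma>\<^esub> inv\<^bsub>U \<Gamma>\<^esub> ?x \<otimes>\<^bsub>U \<Gamma>\<^esub> inv\<^bsub>U \<Gamma>\<^esub> ?y"
        using k(2,3) by (simp add: G.inv_mult_group G.m_assoc)
      also have "\<dots> = (\<one>, monomial R (\<one> \<otimes> a) p)"
        by (rule G.commutator_eqI[OF k(2-4,1)])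
      finally show ?thesis using a by simp
    qed
  qed
  have "(\<one>, x) \<in> generate (U \<Gamma>) ?C" if "x \<in> FS B" for x
    using closed_B that
  proof (induction rule: circ_induct)
    case zero
    then show ?case using generate.one[of "U \<Gamma>" ?C] by (simp add: one_U)
  next
    case (step p a y)
    have "(\<one>, circ (monomial R a p) y) = (\<one>, monomial R a p) \<otimes>\<^bsub>U \<Gamma>\<^esub> (\<one>, y)"
      using step by (simp add: mult_U[where T = B] monomial_FS)
    then show ?case using generate.eng[OF elem[OF step(1,2)] step(4)] by simp
  qed
  then show "carrier (U B) \<subseteq> commutator_subgroup (U \<Gamma>) (carrier (U A)) (carrier (U \<Gamma>))"
    unfolding commutator_subgroup_def carrier_U[of B] by blast
qed

lemma factor_iso: "U A Mod carrier (U B) \<cong> sum_group (A - B) (\<lambda>_. add_monoid R)"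
proof -
  let ?S = "sum_group (A - B) (\<lambda>_. add_monoid R)"
  \<comment> \<open>The restriction yields \<open>undefined\<close> off \<open>A - B\<close>, as the
    extensional functions in \<open>sum_group\<close> require.\<close>
  let ?\<phi> = "\<lambda>g :: 'r \<times> ('i \<times> 'i \<Rightarrow> 'r). \<lambda>p\<in>A - B. snd g p"
  have S: "carrier ?S = {x \<in> (A - B) \<rightarrow>\<^sub>E carrier R. finite {p \<in> A - B. x p \<noteq> \<zero>}}"
    using add.group_axioms by (subst carrier_sum_group) auto
  have \<phi>_in: "?\<phi> (\<one>, x) \<in> carrier ?S" if "x \<in> FS A" for x
  proof -
    have "finite {p \<in> A - B. x p \<noteq> \<zero>}"
      by (rule finite_subset[OF _ FS_finite[OF that]]) blast
    moreover have "{p \<in> A - B. ?\<phi> (\<one>, x) p \<noteq> \<zero>} = {p \<in> A - B. x p \<noteq> \<zero>}" by auto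
    ultimately show ?thesis using FS_carrier[OF that] unfolding S by simp
  qed
  have "?\<phi> \<in> hom (U A) ?S"
  proof (rule homI)
    fix g h assume "g \<in> carrier (U A)" "h \<in> carrier (U A)"
    then obtain x y where x: "g = (\<one>, x)" "x \<in> FS A" and y: "h = (\<one>, y)" "y \<in> FS A"
      by (auto simp: carrier_U)
    \<comment> \<open>Both factors are supported in \<open>A\<close>, hence in \<Gamma> as well, so
      their product is supported in \<open>B\<close>.\<close>
    have "circ x y p = x p \<oplus> y p" if "p \<notin> B" for p
      using M_zero_outside(1)[OF x(2) FS_mono[OF y(2) A_sub] that]
        FS_carrier[OF x(2)] FS_carrier[OF y(2)] by (simp add: circ_def)
    then show "?\<phi> (g \<otimes>\<^bsub>U A\<^esub> h) = ?\<phi> g \<otimes>\<^bsub>?S\<^esub> ?\<phi> h"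
      using x y by (auto simp: mult_U[where T = A])
  qed (use \<phi>_in in \<open>auto simp: carrier_U\<close>)
  then interpret group_hom "U A" ?S ?\<phi>
    using group_U[OF closed_A] add.group_axioms
    by (simp add: group_hom_def group_hom_axioms_def)
  have "?\<phi> ` carrier (U A) = carrier ?S"
  proof
    show "?\<phi> ` carrier (U A) \<subseteq> carrier ?S" by (rule image_subsetI) (rule hom_closed)
    show "carrier ?S \<subseteq> ?\<phi> ` carrier (U A)"
    proof
      fix y assume y: "y \<in> carrier ?S"
      \<comment> \<open>The function \<open>y\<close> is \<open>undefined\<close> off
        \<open>A - B\<close>; its values there are reset to zero to obtain an element of the
        span.\<close>
      define x where "x = (\<lambda>p. if p \<in> A - B then y p else \<zero>)"
      have "{p. x p \<noteq> \<zero>} = {p \<in> A - B. y p \<noteq> \<zero>}" by (auto simp: x_def)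
      then have "x \<in> FS A"
        using y unfolding S free_span_def by (auto simp: x_def)
      moreover have "y = ?\<phi> (\<one>, x)"
        using y unfolding S by (auto simp: x_def PiE_iff extensional_def)
      ultimately show "y \<in> ?\<phi> ` carrier (U A)"
        unfolding carrier_U image_image by blast
    qed
  qed
  moreover have "kernel (U A) ?S ?\<phi> = carrier (U B)"
  proof -
    have "?\<phi> (\<one>, x) = \<one>\<^bsub>?S\<^esub> \<longleftrightarrow> x \<in> FS B" if "x \<in> FS A" for x
    proof
      assume "?\<phi> (\<one>, x) = \<one>\<^bsub>?S\<^esub>"
      then have eq: "(\<lambda>p\<in>A - B. x p) = (\<lambda>p\<in>A - B. \<zero>)" by simp
      show "x \<in> FS B"
        using that
      proof (rule FS_restrict)
        fix p assume "p \<in> A" "p \<notin> B"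
        then show "x p = \<zero>" using fun_cong[OF eq, of p] by simp
      qed
    next
      assume "x \<in> FS B"
      then show "?\<phi> (\<one>, x) = \<one>\<^bsub>?S\<^esub>" by (auto intro!: restrict_ext dest: FS_outside)
    qed
    then show ?thesis
      using FS_mono[OF _ bracket_sub] unfolding kernel_def carrier_U by blast
  qed
  ultimately show ?thesis using FactGroup_iso by simp
qed

end

section \<open>The series of index sets and the conclusion\<close>

text \<open>The bound on \<open>k\<close> avoids the dummy value at \<open>0\<close>, where this
  recursion fails in general.\<close>

lemma index_gamma_Suc:
  "k \<ge> 1 \<Longrightarrow> index_gamma \<Delta> \<Gamma> (Suc k) = index_bracket \<Delta> (index_gamma \<Delta> \<Gamma> k) \<Gamma>"
  by (cases k) auto

lemma index_bracket_mono: "A \<subseteq> A' \<Longrightarrow> index_bracket \<Delta> A \<Gamma> \<subseteq> index_bracket \<Delta> A' \<Gamma>"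
  unfolding index_bracket_def by blast

text \<open>Closedness of \<Gamma> gives the first inclusion, and monotonicity of the bracket
  propagates it. This is the absorption property required by \<open>pair_ring_ideal\<close>.\<close>

lemma index_gamma_Suc_subset:
  assumes "closed_subset \<Delta> \<Gamma>" "k \<ge> 1"
  shows "index_gamma \<Delta> \<Gamma> (Suc k) \<subseteq> index_gamma \<Delta> \<Gamma> k"
  using assms(2)
proof (induction k rule: nat_induct_at_least)
  case base
  then show ?case using assms(1) by (auto simp: index_bracket_def closed_subset_def)
next
  case (Suc k)
  then show ?case
    using index_bracket_mono[OF Suc.IH] index_gamma_Suc[of "Suc k" \<Delta> \<Gamma>] index_gamma_Suc[of k \<Delta> \<Gamma>]
    by simp
qed

lemma index_gamma_subset:
  assumes "closed_subset \<Delta> \<Gamma>" "k \<ge> 1"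
  shows "index_gamma \<Delta> \<Gamma> k \<subseteq> \<Gamma>"
  using assms(2)
proof (induction k rule: nat_induct_at_least)
  case (Suc k)
  then show ?case using index_gamma_Suc_subset[OF assms(1) Suc.hyps] by blast
qed simp

context pair_ring
begin

lemma pair_ring_ideal_index_gamma:
  assumes "closed_subset \<Delta> \<Gamma>" "k \<ge> 1"
  shows "pair_ring_ideal R \<Delta> \<Gamma> (index_gamma \<Delta> \<Gamma> k)"
  using assms(1) index_gamma_subset[OF assms] index_gamma_Suc_subset[OF assms]
  by unfold_locales (simp_all add: index_gamma_Suc[OF assms(2)])

lemma lower_central_U:
  assumes "closed_subset \<Delta> \<Gamma>" "k \<ge> 1"
  shows "lower_central (U \<Gamma>) k = carrier (U (index_gamma \<Delta> \<Gamma> k))"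
  using assms(2)
proof (induction k rule: nat_induct_at_least)
  case (Suc k)
  then interpret pair_ring_ideal R \<Delta> \<Gamma> "index_gamma \<Delta> \<Gamma> k"
    using pair_ring_ideal_index_gamma assms(1) by blast
  have "lower_central (U \<Gamma>) (Suc k) =
      commutator_subgroup (U \<Gamma>) (lower_central (U \<Gamma>) k) (carrier (U \<Gamma>))"
    using Suc.hyps by (cases k) auto
  then show ?case
    using commutator_subgroup_U by (simp add: Suc.IH index_gamma_Suc[OF Suc.hyps])
qed simp

end

theorem theorem4p2:
  fixes R :: "('r, 'm) ring_scheme"
    and \<Lambda> :: "'i set"
    and \<Delta> \<Gamma> :: "('i \<times> 'i) set"
    and k :: nat
  assumes "ring R"
    and "\<one>\<^bsub>R\<^esub> \<noteq> \<zero>\<^bsub>R\<^esub>"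
    and "\<Delta> \<subseteq> \<Lambda> \<times> \<Lambda>"
    and "axiom_A1 \<Lambda> \<Delta>"
    and "axiom_A2 \<Delta>"
    and "k \<ge> 1"
    and "closed_subset \<Delta> \<Gamma>"
  shows "(unip_group R \<Delta> \<Gamma>)\<lparr>carrier := lower_central (unip_group R \<Delta> \<Gamma>) k\<rparr>
           Mod lower_central (unip_group R \<Delta> \<Gamma>) (k + 1)
         \<cong> sum_group (index_gamma \<Delta> \<Gamma> k - index_gamma \<Delta> \<Gamma> (k + 1)) (\<lambda>_. add_monoid R)"
proof -
  interpret ring R by fact
  \<comment> \<open>(A1) speaks only of indices in \<Lambda>; for any other \<open>i\<close> the
    pair \<open>(i, i)\<close> is outside \<Delta> because \<Delta> lies in
    \<open>\<Lambda> \<times> \<Lambda>\<close>.\<close>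
  interpret pair_ring R \<Delta>
    using assms by unfold_locales (auto simp: axiom_A1_def)
  \<comment> \<open>For this choice of \<open>A\<close> the set \<open>B\<close> is the index set at
    \<open>k + 1\<close>, so \<open>factor_iso\<close> becomes the claim once
    \<open>lower_central_U\<close> has identified both terms of the central series.\<close>
  interpret pair_ring_ideal R \<Delta> \<Gamma> "index_gamma \<Delta> \<Gamma> k"
    using pair_ring_ideal_index_gamma assms by blast
  show ?thesis
    using factor_iso assms(6,7)
    by (simp add: lower_central_U U_carrier_update index_gamma_Suc)
qed

end
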